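(* Let $\alpha>0$, $\beta>0$, $p\in[0,1]$, let $X\sim\mathrm{RTUOMG}(\alpha,\beta,p)$, let $r$ be a positive integer and let $0\le z<1$. Then the $r$th incomplete moment $\phi_r(z)=\int_0^z x^r f_X(x;\alpha,\beta,p)\,dx$ is $$\begin{aligned} \phi_{r}(z)=\;& 2\alpha(1-p)\, B\Big(\frac{r}{\beta}+1, \alpha\Big)\;{}_{2}\delta_{1} \Big(\alpha+1,\Big[\frac{r}{\beta}+1, \alpha+\frac{r}{\beta}+1;z^\beta\Big],-1\Big) \\ & + 4p\alpha^2 \sum_{k=1}^{\infty}\left[\frac{1}{2k-1}\, B\Big(\frac{r}{\beta}+2k, \alpha\Big)\;{}_{2}\delta_{1} \Big(\alpha+1,\Big[\frac{r}{\beta}+2k, \alpha+\frac{r}{\beta}+2k;z^\beta\Big],-1\Big)\right]. \end{aligned}$$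
   Context: For $\alpha,\beta>0$ and $0<x<1$ write $$\omega_{1}^{(-2\alpha,\beta)}(x)=\left(\frac{1+x^\beta}{1-x^\beta}\right)^{-\alpha}.$$ A random variable $X$ has the record-based transmuted unit omega distribution $\mathrm{RTUOMG}(\alpha,\beta,p)$, with $\alpha>0$, $\beta>0$, $p\in[0,1]$, if it is supported on $(0,1)$ with density $$f_{X}(x;\alpha,\beta,p)=\left(\frac{2\alpha\beta x^{\beta-1}}{1-x^{2\beta}}\right)\omega_{1}^{(-2\alpha,\beta)}(x)\left[ 1-p-p \log \left(\omega_{1}^{(-2\alpha,\beta)}(x)\right) \right],\qquad 0<x<1.$$ $B(a,b)=\int_0^1 t^{a-1}(1-t)^{b-1}\,dt$ is the beta function and $B_\lambda(m,n)=\int_0^\lambda t^{m-1}(1-t)^{n-1}\,dt$ ($m,n>0$, $0\le\lambda<1$) is the incomplete beta function. For $a>b>0$ and $0\le\lambda<1$, the incomplete Pochhammer ratio is $$[b,a;\lambda]_i=\frac{B_\lambda(b+i,a-b)}{B(b,a-b)},\qquad i=0,1,2,\dots,$$ and the incomplete Gauss hypergeometric function is $${}_{2}\delta_{1}(c,[b,a;\lambda],x)=\sum_{i=0}^\infty (c)_i\,[b,a;\lambda]_i\,\frac{x^i}{i!},$$ where $(c)_i=c(c+1)\cdots(c+i-1)$ and $(c)_0=1$. *)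

theory Defs
  imports "HOL-Probability.Probability"
begin

text \<open>\<open>omega1 \<alpha> \<beta> x\<close> is $\omega_1^{(-2\alpha,\beta)}(x)$: the parameter is the exponent \<open>\<alpha>\<close>,
  not the superscript \<open>-2\<alpha>\<close>.\<close>

definition omega1 :: "real \<Rightarrow> real \<Rightarrow> real \<Rightarrow> real" where
  "omega1 \<alpha> \<beta> x = ((1 + x powr \<beta>) / (1 - x powr \<beta>)) powr (- \<alpha>)"

definition rtuomg_density :: "real \<Rightarrow> real \<Rightarrow> real \<Rightarrow> real \<Rightarrow> real" where
  "rtuomg_density \<alpha> \<beta> p x =
     (if 0 < x \<and> x < 1
      then (2 * \<alpha> * \<beta> * x powr (\<beta> - 1) / (1 - x powr (2 * \<beta>))) * omega1 \<alpha> \<beta> x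
             * (1 - p - p * ln (omega1 \<alpha> \<beta> x))
      else 0)"

definition RTUOMG :: "'a measure \<Rightarrow> ('a \<Rightarrow> real) \<Rightarrow> real \<Rightarrow> real \<Rightarrow> real \<Rightarrow> bool" where
  "RTUOMG M X \<alpha> \<beta> p \<longleftrightarrow>
     prob_space M \<and> distributed M lborel X (\<lambda>x. ennreal (rtuomg_density \<alpha> \<beta> p x))"

text \<open>Incomplete moment, up to \<open>z\<close>, of a distribution on the positive half-line with density \<open>f\<close>.\<close>

definition incomplete_moment :: "(real \<Rightarrow> real) \<Rightarrow> nat \<Rightarrow> real \<Rightarrow> real" where
  "incomplete_moment f r z = (LBINT x:{0..z}. x ^ r * f x)"

text \<open>The complete beta function is the library's \<^const>\<open>Beta\<close>, defined there through \<^const>\<open>Gamma\<close>;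
  for positive arguments it is Euler's integral.\<close>

lemma Beta_eq_integral:
  fixes a b :: real
  assumes "a > 0" "b > 0"
  shows "Beta a b = integral {0..1} (\<lambda>t. t powr (a - 1) * (1 - t) powr (b - 1))"
  using has_integral_Beta_real[OF assms] by (simp add: integral_unique)

definition incomplete_Beta :: "real \<Rightarrow> real \<Rightarrow> real \<Rightarrow> real" where
  "incomplete_Beta l m n = (LBINT t:{0..l}. t powr (m - 1) * (1 - t) powr (n - 1))"

text \<open>The incomplete Pochhammer ratio $[b,a;\lambda]_i$.\<close>

definition incomplete_pochhammer_ratio :: "real \<Rightarrow> real \<Rightarrow> real \<Rightarrow> nat \<Rightarrow> real" where
  "incomplete_pochhammer_ratio b a l i = incomplete_Beta l (b + real i) (a - b) / Beta b (a - b)"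

text \<open>The incomplete Gauss hypergeometric function ${}_2\delta_1(c,[b,a;\lambda],x)$. Its terms are named
  separately so that convergence can be stated alongside the value given by \<^const>\<open>suminf\<close>.\<close>

definition incomplete_gauss_term ::
    "real \<Rightarrow> real \<Rightarrow> real \<Rightarrow> real \<Rightarrow> real \<Rightarrow> nat \<Rightarrow> real" where
  "incomplete_gauss_term c b a l x i =
     pochhammer c i * incomplete_pochhammer_ratio b a l i * (x ^ i / fact i)"

definition incomplete_gauss :: "real \<Rightarrow> real \<Rightarrow> real \<Rightarrow> real \<Rightarrow> real \<Rightarrow> real" where
  "incomplete_gauss c b a l x = (\<Sum>i. incomplete_gauss_term c b a l x i)"

end

theory Submission
  imports Defs
begin

text \<open>
  The substitution \<open>u = x powr \<beta>\<close> carries the incomplete moment to the integral over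
  \<open>0 \<le> u \<le> z powr \<beta>\<close> of
  \[ 2\alpha\, u^{r/\beta} (1-u)^{\alpha-1} (1+u)^{-(\alpha+1)}
     \Bigl[1 - p + p\alpha \log\frac{1+u}{1-u}\Bigr], \]
  because $(1-u^2)^{-1} \bigl(\frac{1+u}{1-u}\bigr)^{-\alpha} = (1-u)^{\alpha-1}(1+u)^{-\alpha-1}$.
  The proof then expands twice under the integral sign. The first expansion is
  $\log\frac{1+u}{1-u} = 2\sum_{k\ge1} u^{2k-1}/(2k-1)$, which leaves only integrals of
  $u^{b-1}(1-u)^{\alpha-1}(1+u)^{-(\alpha+1)}$ with \<open>b = r/\<beta> + 1\<close> or \<open>b = r/\<beta> + 2k\<close>. The second
  is the binomial series of $(1+u)^{-(\alpha+1)}$; it turns each of them into a series of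
  incomplete beta integrals, which is \<open>Beta b \<alpha>\<close> times an incomplete Gauss function. This is Euler's
  integral representation of \<open>\<^sub>2F\<^sub>1\<close>, truncated at \<open>z powr \<beta>\<close> (\<open>incomplete_gauss_term_sums\<close>).

  Since \<open>z powr \<beta> < 1\<close>, both power series are bounded on the range of integration by a convergent
  numerical series, so both interchanges come from one dominated form of term-by-term
  integration (\<open>set_integral_sums_dominated\<close>), the weight being the integrable factor that is not expanded.
\<close>

section \<open>Term-by-term integration\<close>

lemma set_integrable_mult_bounded:
  fixes w g :: "'b \<Rightarrow> real"
  assumes w: "set_integrable M A w" and A[measurable]: "A \<in> sets M"
    and g[measurable]: "g \<in> borel_measurable M"
    and bound: "\<And>x. x \<in> A \<Longrightarrow> \<bar>g x\<bar> \<le> C"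
  shows "set_integrable M A (\<lambda>x. g x * w x)"
proof -
  have w': "integrable M (\<lambda>x. indicator A x * w x)"
    using w by (simp add: set_integrable_def)
  have "integrable M (\<lambda>x. g x * (indicator A x * w x))"
  proof (rule Bochner_Integration.integrable_bound[where f = "\<lambda>x. C * (indicator A x * w x)"])
    show "integrable M (\<lambda>x. C * (indicator A x * w x))"
      using w' by simp
    show "(\<lambda>x. g x * (indicator A x * w x)) \<in> borel_measurable M"
      using w' by measurable
    have "norm (g x * (indicator A x * w x)) \<le> norm (C * (indicator A x * w x))" for x
    proof (cases "x \<in> A")
      case True
      then have "\<bar>g x\<bar> \<le> \<bar>C\<bar>" using bound[of x] by linarith
      then show ?thesis
        by (simp add: abs_mult mult_right_mono)
    qed auto
    then show "AE x in M. norm (g x * (indicator A x * w x)) \<le> norm (C * (indicator A x * w x))"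
      by simp
  qed
  then show ?thesis
    by (simp add: set_integrable_def mult_ac)
qed

text \<open>The Weierstrass M-test under the integral sign: a series dominated by constants \<open>m i\<close> may be
  integrated term by term against any integrable weight.\<close>

lemma set_integral_sums_dominated:
  fixes w :: "'b \<Rightarrow> real" and g :: "nat \<Rightarrow> 'b \<Rightarrow> real"
  assumes w: "set_integrable M A w" and A[measurable]: "A \<in> sets M"
    and g[measurable]: "\<And>i. g i \<in> borel_measurable M"
    and bound: "\<And>i x. x \<in> A \<Longrightarrow> \<bar>g i x\<bar> \<le> m i"
    and m: "summable m"
    and sums: "\<And>x. x \<in> A \<Longrightarrow> (\<lambda>i. g i x) sums G x"
  shows "set_integrable M A (\<lambda>x. G x * w x)"
    and "(\<lambda>i. LINT x:A|M. g i x * w x) sums (LINT x:A|M. G x * w x)"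
proof -
  define f where "f i x = indicator A x * (g i x * w x)" for i x
  have w': "integrable M (\<lambda>x. indicator A x * w x)"
    using w by (simp add: set_integrable_def)
  have int: "integrable M (f i)" for i
    using set_integrable_mult_bounded[OF w A g bound, of i]
    by (simp add: set_integrable_def f_def[abs_def])
  have bnd: "norm (f i x) \<le> m i * norm (indicator A x * w x)" for i x
    using bound[of x i] by (auto simp: f_def indicator_def abs_mult mult_right_mono)
  have sm: "summable (\<lambda>i. norm (f i x))" for x
    by (rule summable_comparison_test[where g = "\<lambda>i. m i * norm (indicator A x * w x)"])
       (use bnd m in \<open>auto intro: summable_mult2\<close>)
  have sn: "summable (\<lambda>i. \<integral>x. norm (f i x) \<partial>M)"
  proof (rule summable_comparison_test)
    have "norm (\<integral>x. norm (f i x) \<partial>M) \<le> m i * (\<integral>x. norm (indicator A x * w x) \<partial>M)" for i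
    proof -
      have "(\<integral>x. norm (f i x) \<partial>M) \<le> (\<integral>x. m i * norm (indicator A x * w x) \<partial>M)"
        using int[of i] w' bnd[of i] by (intro integral_mono) auto
      then show ?thesis by simp
    qed
    then show "\<exists>N. \<forall>i\<ge>N. norm (\<integral>x. norm (f i x) \<partial>M) \<le> m i * (\<integral>x. norm (indicator A x * w x) \<partial>M)"
      by blast
    show "summable (\<lambda>i. m i * (\<integral>x. norm (indicator A x * w x) \<partial>M))"
      using m by (rule summable_mult2)
  qed
  have lim: "(\<Sum>i. f i x) = indicator A x * (G x * w x)" for x
  proof (cases "x \<in> A")
    case True
    then show ?thesis
      using sums_mult2[OF sums[OF True], of "w x"] by (simp add: f_def sums_iff)
  qed (simp add: f_def)
  have "integrable M (\<lambda>x. \<Sum>i. f i x)"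
    by (rule integrable_suminf[OF int _ sn]) (intro AE_I2 sm)
  then show "set_integrable M A (\<lambda>x. G x * w x)"
    by (simp add: lim set_integrable_def)
  have "(\<lambda>i. integral\<^sup>L M (f i)) sums (\<integral>x. (\<Sum>i. f i x) \<partial>M)"
    by (rule sums_integral[OF int _ sn]) (intro AE_I2 sm)
  then show "(\<lambda>i. LINT x:A|M. g i x * w x) sums (LINT x:A|M. G x * w x)"
    unfolding lim by (simp add: f_def[abs_def] set_lebesgue_integral_def)
qed

section \<open>Euler's integral for the incomplete Gauss function\<close>

lemma set_integrable_Beta:
  fixes a b l :: real
  assumes "a > 0" "b > 0" "l \<le> 1"
  shows "set_integrable lborel {0..l} (\<lambda>u. u powr (a - 1) * (1 - u) powr (b - 1))"
proof -
  let ?f = "\<lambda>u::real. u powr (a - 1) * (1 - u) powr (b - 1)"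
  have "?f absolutely_integrable_on {0..1}"
    using has_integral_Beta_real[of a b] assms
    by (intro nonnegative_absolutely_integrable_1) (auto simp: has_integral_iff)
  then have "set_integrable lborel {0..1} ?f"
    unfolding set_integrable_def by (subst (asm) integrable_completion) auto
  then show ?thesis
    by (rule set_integrable_subset) (use assms in auto)
qed

lemma summable_abs_gbinomial_power:
  fixes a l :: real
  assumes "0 \<le> l" "l < 1"
  shows "summable (\<lambda>n. \<bar>a gchoose n\<bar> * l ^ n)"
proof -
  obtain y where y: "l < y" "y < 1"
    using assms(2) dense by blast
  have "summable (\<lambda>n. (a gchoose n) * y ^ n)"
    using gen_binomial_real[of y a] y assms by (auto simp: sums_iff)
  then have "summable (\<lambda>n. norm ((a gchoose n) * l ^ n))"
    by (rule powser_insidea) (use y assms in auto)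
  then show ?thesis
    using assms by (simp add: abs_mult)
qed

text \<open>With \<open>b - 1\<close> and \<open>a - b - 1\<close> the exponents of the weight, the binomial series of
  \<open>(1 - x * u) powr (- c)\<close> contributes the powers \<open>u ^ i\<close> that raise the first exponent to
  \<open>b + i - 1\<close>. On \<open>0 \<le> u \<le> l\<close> its argument satisfies \<open>\<bar>x * u\<bar> \<le> l < 1\<close>, so that even at
  \<open>\<bar>x\<bar> = 1\<close> it is dominated by its own absolute series at \<open>l\<close>.\<close>

lemma incomplete_gauss_term_sums:
  fixes a b c l x :: real
  assumes b: "0 < b" "b < a" and l: "0 \<le> l" "l < 1" and x: "\<bar>x\<bar> \<le> 1"
  shows "incomplete_gauss_term c b a l x sums
    ((LBINT u:{0..l}. (1 - x * u) powr (- c) * (u powr (b - 1) * (1 - u) powr (a - b - 1)))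
      / Beta b (a - b))"
proof -
  let ?w = "\<lambda>u::real. u powr (b - 1) * (1 - u) powr (a - b - 1)"
  let ?g = "\<lambda>i u. ((- c) gchoose i) * (- x * u) ^ i"
  have small: "\<bar>x * u\<bar> \<le> l" if "u \<in> {0..l}" for u
    using that x l mult_mono[of "\<bar>x\<bar>" 1 u l] by (simp add: abs_mult)
  have sums: "(\<lambda>i. LBINT u:{0..l}. ?g i u * ?w u) sums (LBINT u:{0..l}. (1 - x * u) powr (- c) * ?w u)"
  proof (rule set_integral_sums_dominated)
    show "set_integrable lborel {0..l} ?w"
      using set_integrable_Beta[of b "a - b" l] b l by simp
    show "\<bar>?g i u\<bar> \<le> \<bar>(- c) gchoose i\<bar> * l ^ i" if "u \<in> {0..l}" for i u
      using small[OF that] by (simp add: abs_mult power_abs mult_left_mono power_mono flip: power_mult_distrib)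
    show "summable (\<lambda>i. \<bar>(- c) gchoose i\<bar> * l ^ i)"
      by (rule summable_abs_gbinomial_power[OF l])
    show "(\<lambda>i. ?g i u) sums (1 - x * u) powr (- c)" if "u \<in> {0..l}" for u
      using gen_binomial_real[of "- x * u" "- c"] small[OF that] l by simp
  qed auto
  have coeff: "(LBINT u:{0..l}. ?g i u * ?w u) / Beta b (a - b) = incomplete_gauss_term c b a l x i"
    for i
  proof -
    have "(LBINT u:{0..l}. ?g i u * ?w u)
        = (LBINT u:{0..l}. pochhammer c i * (x ^ i / fact i) *
            (u powr (b + real i - 1) * (1 - u) powr (a - b - 1)))"
    proof (rule set_lebesgue_integral_cong; clarsimp)
      fix u :: real assume "0 \<le> u"
      then have "u ^ i * u powr (b - 1) = u powr (b + real i - 1)"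
        by (cases "u = 0") (auto simp: powr_add powr_diff powr_realpow)
      moreover have "((- c) gchoose i) * (- (x * u)) ^ i = pochhammer c i * (x ^ i / fact i) * u ^ i"
      proof -
        have "(- (x * u)) ^ i = (- 1) ^ i * (x ^ i * u ^ i)"
          by (simp add: power_minus[of "x * u"] power_mult_distrib)
        moreover have "(- 1 :: real) ^ i * (- 1) ^ i = 1"
          by (simp flip: power_mult_distrib)
        ultimately show ?thesis
          by (simp add: gbinomial_pochhammer mult_ac)
      qed
      ultimately show "((- c) gchoose i) * (- (x * u)) ^ i * (u powr (b - 1) * (1 - u) powr (a - b - 1))
          = pochhammer c i * x ^ i * (u powr (b + real i - 1) * (1 - u) powr (a - b - 1)) / fact i"
        by (simp add: mult_ac)
    qed
    then show ?thesis
      by (simp add: incomplete_gauss_term_def incomplete_pochhammer_ratio_def incomplete_Beta_def mult_ac)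
  qed
  show ?thesis
    using sums_divide[OF sums, of "Beta b (a - b)"] by (simp only: coeff)
qed

section \<open>The moment kernel\<close>

text \<open>In the variable \<open>u = x powr \<beta>\<close>, with \<open>s = r / \<beta>\<close>, this is
  \<open>x ^ r * omega1 \<alpha> \<beta> x / (1 - x powr (2 * \<beta>))\<close>. It is also Euler's integrand for
  \<open>b = s + 1\<close>, \<open>a - b = \<alpha>\<close>, \<open>c = \<alpha> + 1\<close> at the argument \<open>- 1\<close>.\<close>

definition moment_kernel :: "real \<Rightarrow> real \<Rightarrow> real \<Rightarrow> real" where
  "moment_kernel \<alpha> s u = u powr s * (1 - u) powr (\<alpha> - 1) * (1 + u) powr (- (\<alpha> + 1))"

lemma measurable_moment_kernel [measurable]: "moment_kernel \<alpha> s \<in> borel_measurable borel"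
  unfolding moment_kernel_def by measurable

lemma set_integrable_moment_kernel:
  assumes "\<alpha> > 0" "s > - 1" "l \<le> 1"
  shows "set_integrable lborel {0..l} (moment_kernel \<alpha> s)"
proof -
  have "(1 + u) powr (- (\<alpha> + 1)) \<le> 1" if "u \<ge> 0" for u :: real
    using that assms powr_mono[of "- (\<alpha> + 1)" 0 "1 + u"] by simp
  then have "set_integrable lborel {0..l}
      (\<lambda>u. (1 + u) powr (- (\<alpha> + 1)) * (u powr (s + 1 - 1) * (1 - u) powr (\<alpha> - 1)))"
    using assms by (intro set_integrable_mult_bounded[where C = 1] set_integrable_Beta) auto
  then show ?thesis
    by (rule set_integrable_cong[THEN iffD1, rotated -1]) (auto simp: moment_kernel_def mult_ac)
qed

lemma moment_kernel_gauss:
  assumes "\<alpha> > 0" "s > - 1" "0 \<le> l" "l < 1"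
  shows "summable (incomplete_gauss_term (\<alpha> + 1) (s + 1) (\<alpha> + (s + 1)) l (- 1))"
    and "Beta (s + 1) \<alpha> * incomplete_gauss (\<alpha> + 1) (s + 1) (\<alpha> + (s + 1)) l (- 1)
      = (LBINT u:{0..l}. moment_kernel \<alpha> s u)"
proof -
  have pos: "Beta (s + 1) \<alpha> > 0"
    using assms by (simp add: Beta_def)
  have "(LBINT u:{0..l}. (1 - (- 1) * u) powr (- (\<alpha> + 1)) * (u powr (s + 1 - 1) * (1 - u) powr (\<alpha> + (s + 1) - (s + 1) - 1)))
      = (LBINT u:{0..l}. moment_kernel \<alpha> s u)"
    by (rule set_lebesgue_integral_cong) (auto simp: moment_kernel_def mult_ac)
  then have "incomplete_gauss_term (\<alpha> + 1) (s + 1) (\<alpha> + (s + 1)) l (- 1) sums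
      ((LBINT u:{0..l}. moment_kernel \<alpha> s u) / Beta (s + 1) \<alpha>)"
    using incomplete_gauss_term_sums[of "s + 1" "\<alpha> + (s + 1)" l "- 1" "\<alpha> + 1"] assms by simp
  then show "summable (incomplete_gauss_term (\<alpha> + 1) (s + 1) (\<alpha> + (s + 1)) l (- 1))"
    and "Beta (s + 1) \<alpha> * incomplete_gauss (\<alpha> + 1) (s + 1) (\<alpha> + (s + 1)) l (- 1)
      = (LBINT u:{0..l}. moment_kernel \<alpha> s u)"
    using pos by (simp_all add: incomplete_gauss_def sums_iff)
qed

section \<open>The logarithmic factor\<close>

text \<open>The odd series for \<open>ln y\<close> runs in powers of \<open>(y - 1) / (y + 1)\<close>, which is \<open>u\<close> for
  \<open>y = (1 + u) / (1 - u)\<close>.\<close>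

lemma ln_quotient_sums:
  fixes u :: real
  assumes "0 \<le> u" "u < 1"
  shows "(\<lambda>j. 2 * u ^ (2 * j + 1) / real (2 * j + 1)) sums ln ((1 + u) / (1 - u))"
proof -
  have "((1 + u) / (1 - u) - 1) / ((1 + u) / (1 - u) + 1) = u"
    using assms by (simp add: field_simps)
  then show ?thesis
    using ln_series_quadratic[of "(1 + u) / (1 - u)"] assms by simp
qed

text \<open>A factor \<open>u ^ (2 * j + 1)\<close> only shifts the parameter \<open>s\<close> of the kernel, so the logarithm turns
  into a series of shifted kernels. The series is dominated by its value at \<open>u = l\<close>, which is finite.\<close>

lemma moment_kernel_ln_sums:
  assumes "\<alpha> > 0" "s > - 1" "0 \<le> l" "l < 1"
  shows "set_integrable lborel {0..l} (\<lambda>u. ln ((1 + u) / (1 - u)) * moment_kernel \<alpha> s u)"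
    and "(\<lambda>j. 2 / real (2 * j + 1) * (LBINT u:{0..l}. moment_kernel \<alpha> (s + real (2 * j + 1)) u))
      sums (LBINT u:{0..l}. ln ((1 + u) / (1 - u)) * moment_kernel \<alpha> s u)"
proof -
  let ?g = "\<lambda>j u. 2 * u ^ (2 * j + 1) / real (2 * j + 1)"
  have bound: "\<bar>?g j u\<bar> \<le> ?g j l" if "u \<in> {0..l}" for j u
    using that by (auto intro!: divide_right_mono mult_mono power_mono simp: abs_mult)
  have smm: "summable (\<lambda>j. ?g j l)"
    using ln_quotient_sums[of l] assms by (simp add: sums_iff)
  have lim: "(\<lambda>j. ?g j u) sums ln ((1 + u) / (1 - u))" if "u \<in> {0..l}" for u
    by (rule ln_quotient_sums) (use that assms in auto)
  have w: "set_integrable lborel {0..l} (moment_kernel \<alpha> s)"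
    using assms by (intro set_integrable_moment_kernel) auto
  note tbt = set_integral_sums_dominated[OF w _ _ bound smm lim]
  show "set_integrable lborel {0..l} (\<lambda>u. ln ((1 + u) / (1 - u)) * moment_kernel \<alpha> s u)"
    by (rule tbt) auto
  have "(\<lambda>j. LBINT u:{0..l}. ?g j u * moment_kernel \<alpha> s u)
      sums (LBINT u:{0..l}. ln ((1 + u) / (1 - u)) * moment_kernel \<alpha> s u)"
    by (rule tbt) auto
  moreover have "(LBINT u:{0..l}. ?g j u * moment_kernel \<alpha> s u)
      = 2 / real (2 * j + 1) * (LBINT u:{0..l}. moment_kernel \<alpha> (s + real (2 * j + 1)) u)" for j
  proof -
    have "u ^ (2 * j + 1) * moment_kernel \<alpha> s u = moment_kernel \<alpha> (s + real (2 * j + 1)) u"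
      if "0 \<le> u" for u :: real
    proof (cases "u = 0")
      case False
      then have "u powr (s + real (2 * j + 1)) = u powr s * u ^ (2 * j + 1)"
        using that by (subst powr_add, subst powr_realpow) auto
      then show ?thesis
        unfolding moment_kernel_def by (simp only: mult_ac)
    qed (simp add: moment_kernel_def)
    then have "(LBINT u:{0..l}. ?g j u * moment_kernel \<alpha> s u)
      = (LBINT u:{0..l}. 2 / real (2 * j + 1) * moment_kernel \<alpha> (s + real (2 * j + 1)) u)"
      by (intro set_lebesgue_integral_cong) (auto simp: mult.assoc)
    then show ?thesis by simp
  qed
  ultimately show "(\<lambda>j. 2 / real (2 * j + 1) * (LBINT u:{0..l}. moment_kernel \<alpha> (s + real (2 * j + 1)) u))
      sums (LBINT u:{0..l}. ln ((1 + u) / (1 - u)) * moment_kernel \<alpha> s u)"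
    by simp
qed

section \<open>Change of variables\<close>

lemma lborel_Icc_eq_lebesgue_Ioo:
  fixes f :: "real \<Rightarrow> real"
  assumes [measurable]: "f \<in> borel_measurable borel"
  shows "set_integrable lborel {a..b} f \<longleftrightarrow> f absolutely_integrable_on {a<..<b}"
    and "(LBINT x:{a..b}. f x) = (LINT x:{a<..<b}|lebesgue. f x)"
proof -
  have ae: "AE x in lborel. indicator {a..b} x *\<^sub>R f x = indicator {a<..<b} x *\<^sub>R f x"
    using AE_lborel_singleton[of a] AE_lborel_singleton[of b]
    by eventually_elim (auto simp: indicator_def)
  show "set_integrable lborel {a..b} f \<longleftrightarrow> f absolutely_integrable_on {a<..<b}"
    unfolding set_integrable_def
    by (subst integrable_completion, simp, rule integrable_cong_AE[OF _ _ ae]) auto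
  show "(LBINT x:{a..b}. f x) = (LINT x:{a<..<b}|lebesgue. f x)"
    unfolding set_lebesgue_integral_def
    by (subst integral_completion, simp, rule integral_cong_AE[OF _ _ ae]) auto
qed

text \<open>The substitution is made on the open interval, since \<open>\<lambda>x. x powr \<beta>\<close> is not differentiable
  at \<open>0\<close> when \<open>\<beta> < 1\<close>; the end points are null sets.\<close>

lemma set_integral_powr_substitution:
  fixes f h :: "real \<Rightarrow> real"
  assumes \<beta>: "\<beta> > 0" and z: "0 \<le> z"
    and [measurable]: "f \<in> borel_measurable borel" "h \<in> borel_measurable borel"
    and eq: "\<And>x. 0 < x \<Longrightarrow> x < z \<Longrightarrow> f x = \<beta> * x powr (\<beta> - 1) * h (x powr \<beta>)"
    and h: "set_integrable lborel {0..z powr \<beta>} h"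
  shows "set_integrable lborel {0..z} f"
    and "(LBINT x:{0..z}. f x) = (LBINT u:{0..z powr \<beta>}. h u)"
proof -
  have image: "(\<lambda>x. x powr \<beta>) ` {0<..<z} = {0<..<z powr \<beta>}"
  proof (rule set_eqI, rule iffI)
    fix u assume u: "u \<in> {0<..<z powr \<beta>}"
    have "u powr (1 / \<beta>) < (z powr \<beta>) powr (1 / \<beta>)"
      using u \<beta> by (intro powr_less_mono2) auto
    then have "u powr (1 / \<beta>) \<in> {0<..<z}"
      using u \<beta> z by (simp add: powr_powr)
    moreover have "u = (u powr (1 / \<beta>)) powr \<beta>"
      using u \<beta> by (simp add: powr_powr)
    ultimately show "u \<in> (\<lambda>x. x powr \<beta>) ` {0<..<z}"
      by blast
  qed (use \<beta> in \<open>auto intro!: powr_less_mono2\<close>)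
  have inj: "inj_on (\<lambda>x. x powr \<beta>) {0<..<z}"
    using \<beta> by (intro inj_on_inverseI[where g = "\<lambda>u. u powr (1 / \<beta>)"]) (simp add: powr_powr)
  have deriv: "((\<lambda>x. x powr \<beta>) has_field_derivative \<beta> * x powr (\<beta> - 1)) (at x within {0<..<z})"
    if "x \<in> {0<..<z}" for x
    using that by (auto intro!: derivative_eq_intros)
  have eq': "\<bar>\<beta> * x powr (\<beta> - 1)\<bar> * h (x powr \<beta>) = f x" if "x \<in> {0<..<z}" for x
    using eq[of x] that \<beta> by (simp add: abs_mult)
  note lborel_h = lborel_Icc_eq_lebesgue_Ioo[where f = h and a = 0 and b = "z powr \<beta>"]
  note lborel_f = lborel_Icc_eq_lebesgue_Ioo[where f = f and a = 0 and b = z]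
  have hI: "h absolutely_integrable_on {0<..<z powr \<beta>}"
    using h by (simp add: lborel_h)
  have "(\<lambda>x. \<bar>\<beta> * x powr (\<beta> - 1)\<bar> * h (x powr \<beta>)) absolutely_integrable_on {0<..<z} \<and>
      integral {0<..<z} (\<lambda>x. \<bar>\<beta> * x powr (\<beta> - 1)\<bar> * h (x powr \<beta>)) = integral {0<..<z powr \<beta>} h"
    using has_absolute_integral_change_of_variables_1'[OF _ deriv inj, of h "integral {0<..<z powr \<beta>} h"]
      hI by (simp add: image)
  moreover have "(\<lambda>x. \<bar>\<beta> * x powr (\<beta> - 1)\<bar> * h (x powr \<beta>)) absolutely_integrable_on {0<..<z}
      \<longleftrightarrow> f absolutely_integrable_on {0<..<z}"
    by (rule set_integrable_cong) (use eq' in auto)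
  moreover have "integral {0<..<z} (\<lambda>x. \<bar>\<beta> * x powr (\<beta> - 1)\<bar> * h (x powr \<beta>)) = integral {0<..<z} f"
    by (rule integral_cong) (use eq' in auto)
  ultimately have fI: "f absolutely_integrable_on {0<..<z}"
    and int: "integral {0<..<z} f = integral {0<..<z powr \<beta>} h"
    by auto
  show "set_integrable lborel {0..z} f"
    using fI by (simp add: lborel_f)
  show "(LBINT x:{0..z}. f x) = (LBINT u:{0..z powr \<beta>}. h u)"
    using int set_lebesgue_integral_eq_integral(2)[OF fI] set_lebesgue_integral_eq_integral(2)[OF hI]
    by (simp add: lborel_f lborel_h)
qed

text \<open>Since \<open>ln (omega1 \<alpha> \<beta> x) = - \<alpha> * ln ((1 + u) / (1 - u))\<close> at \<open>u = x powr \<beta>\<close>, the logarithmic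
  term has the coefficient \<open>\<alpha>\<^sup>2\<close> and a positive sign; the factor \<open>\<beta> * x powr (\<beta> - 1)\<close> is the Jacobian.\<close>

lemma rtuomg_density_powr_eq:
  assumes \<beta>: "\<beta> > 0" and x: "0 < x" "x < 1"
  shows "x ^ r * rtuomg_density \<alpha> \<beta> p x = \<beta> * x powr (\<beta> - 1) *
    (2 * \<alpha> * (1 - p) * moment_kernel \<alpha> (real r / \<beta>) (x powr \<beta>) +
     2 * p * \<alpha>\<^sup>2 * (ln ((1 + x powr \<beta>) / (1 - x powr \<beta>)) * moment_kernel \<alpha> (real r / \<beta>) (x powr \<beta>)))"
proof -
  define u where "u = x powr \<beta>"
  define L where "L = ln ((1 + u) / (1 - u))"
  have u: "0 < u" "u < 1"
    using x \<beta> powr_less_mono2[of \<beta> x 1] by (auto simp: u_def)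
  have xr: "x ^ r = u powr (real r / \<beta>)"
    using x \<beta> by (simp add: u_def powr_powr powr_realpow)
  have sq: "x powr (2 * \<beta>) = u\<^sup>2"
    using x by (simp add: u_def power2_eq_square flip: powr_add)
  have om: "omega1 \<alpha> \<beta> x = (1 - u) powr \<alpha> * (1 + u) powr (- \<alpha>)"
    using u by (simp add: omega1_def powr_divide powr_minus_divide flip: u_def)
  have ln: "ln (omega1 \<alpha> \<beta> x) = - \<alpha> * L"
    using u by (simp add: omega1_def L_def ln_powr flip: u_def)
  have "1 - u\<^sup>2 = (1 - u) * (1 + u)"
    by (simp add: power2_eq_square algebra_simps)
  then have ker: "moment_kernel \<alpha> (real r / \<beta>) u = x ^ r * (omega1 \<alpha> \<beta> x / (1 - u\<^sup>2))"
    using u by (simp add: moment_kernel_def xr om powr_diff[of "1 - u"] powr_diff[of "1 + u" "- \<alpha>" 1])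
  have "x ^ r * rtuomg_density \<alpha> \<beta> p x
      = \<beta> * x powr (\<beta> - 1) * (2 * \<alpha> * (1 - p + p * \<alpha> * L) * (x ^ r * (omega1 \<alpha> \<beta> x / (1 - u\<^sup>2))))"
    using x by (simp add: rtuomg_density_def sq ln)
  also have "\<dots> = \<beta> * x powr (\<beta> - 1) * (2 * \<alpha> * (1 - p + p * \<alpha> * L) * moment_kernel \<alpha> (real r / \<beta>) u)"
    by (simp only: ker)
  finally show ?thesis
    by (simp add: algebra_simps power2_eq_square flip: u_def L_def)
qed

lemma measurable_rtuomg_density [measurable]: "rtuomg_density \<alpha> \<beta> p \<in> borel_measurable borel"
  unfolding rtuomg_density_def omega1_def by measurable

section \<open>The incomplete moments\<close>

theorem proposition2p2:
  fixes M :: "'a measure" and X :: "'a \<Rightarrow> real"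
    and \<alpha> \<beta> p z :: real and r :: nat
  assumes "\<alpha> > 0" and "\<beta> > 0" and "0 \<le> p" and "p \<le> 1"
    and "RTUOMG M X \<alpha> \<beta> p"
    and "r > 0" and "0 \<le> z" and "z < 1"
  shows "set_integrable lborel {0..z} (\<lambda>x. x ^ r * rtuomg_density \<alpha> \<beta> p x) \<and>
    summable (incomplete_gauss_term (\<alpha> + 1)
        (real r / \<beta> + 1) (\<alpha> + real r / \<beta> + 1) (z powr \<beta>) (- 1)) \<and>
    (\<forall>k::nat. k \<ge> 1 \<longrightarrow> summable (incomplete_gauss_term (\<alpha> + 1)
        (real r / \<beta> + 2 * real k) (\<alpha> + real r / \<beta> + 2 * real k) (z powr \<beta>) (- 1))) \<and>
    summable (\<lambda>j. let k = real (Suc j) in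
        1 / (2 * k - 1) * Beta (real r / \<beta> + 2 * k) \<alpha>
          * incomplete_gauss (\<alpha> + 1) 
              (real r / \<beta> + 2 * k) (\<alpha> + real r / \<beta> + 2 * k) (z powr \<beta>) (- 1)) \<and>
    incomplete_moment (rtuomg_density \<alpha> \<beta> p) r z =
      2 * \<alpha> * (1 - p) * Beta (real r / \<beta> + 1) \<alpha>
        * incomplete_gauss (\<alpha> + 1)
            (real r / \<beta> + 1) (\<alpha> + real r / \<beta> + 1) (z powr \<beta>) (- 1)
      + 4 * p * \<alpha>\<^sup>2 * (\<Sum>j. let k = real (Suc j) in
          1 / (2 * k - 1) * Beta (real r / \<beta> + 2 * k) \<alpha>
            * incomplete_gauss (\<alpha> + 1)
                (real r / \<beta> + 2 * k) (\<alpha> + real r / \<beta> + 2 * k) (z powr \<beta>) (- 1))"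
proof -
  define s where "s = real r / \<beta>"
  define l where "l = z powr \<beta>"
  have s: "s > - 1"
    using \<open>\<beta> > 0\<close> by (simp add: s_def less_le_trans[of "- 1" 0])
  have l: "0 \<le> l" "l < 1"
    using assms powr_less_mono2[of \<beta> z 1] by (auto simp: l_def)
  let ?K = "moment_kernel \<alpha> s"
  let ?L = "\<lambda>u::real. ln ((1 + u) / (1 - u)) * ?K u"
  let ?h = "\<lambda>u. 2 * \<alpha> * (1 - p) * ?K u + 2 * p * \<alpha>\<^sup>2 * ?L u"
  have K: "set_integrable lborel {0..l} ?K"
    using assms s l by (intro set_integrable_moment_kernel) auto
  note L = moment_kernel_ln_sums[OF \<open>\<alpha> > 0\<close> s l]
  have h: "set_integrable lborel {0..l} ?h"
    using K L(1) by (intro set_integral_add set_integrable_mult_right) auto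
  have int_h: "(LBINT u:{0..l}. ?h u)
      = 2 * \<alpha> * (1 - p) * (LBINT u:{0..l}. ?K u) + 2 * p * \<alpha>\<^sup>2 * (LBINT u:{0..l}. ?L u)"
    using K L(1) by (subst set_integral_add) auto
  have eq: "x ^ r * rtuomg_density \<alpha> \<beta> p x = \<beta> * x powr (\<beta> - 1) * ?h (x powr \<beta>)"
    if "0 < x" "x < z" for x
    unfolding s_def using that assms by (intro rtuomg_density_powr_eq) auto
  have meas: "(\<lambda>x. x ^ r * rtuomg_density \<alpha> \<beta> p x) \<in> borel_measurable borel"
      "?h \<in> borel_measurable borel"
    by measurable
  note subst = set_integral_powr_substitution[OF \<open>\<beta> > 0\<close> \<open>0 \<le> z\<close> meas eq h[unfolded l_def],
      folded l_def]

  note gauss = moment_kernel_gauss[OF \<open>\<alpha> > 0\<close> _ l]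
  have first: "summable (incomplete_gauss_term (\<alpha> + 1) (s + 1) (\<alpha> + s + 1) l (- 1))"
    "Beta (s + 1) \<alpha> * incomplete_gauss (\<alpha> + 1) (s + 1) (\<alpha> + s + 1) l (- 1)
      = (LBINT u:{0..l}. ?K u)"
    using gauss[OF s] by (simp_all add: add.assoc)
  have gauss_k: "summable (incomplete_gauss_term (\<alpha> + 1) (s + 2 * k) (\<alpha> + s + 2 * k) l (- 1))"
    "Beta (s + 2 * k) \<alpha> * incomplete_gauss (\<alpha> + 1) (s + 2 * k) (\<alpha> + s + 2 * k) l (- 1)
      = (LBINT u:{0..l}. moment_kernel \<alpha> (s + 2 * k - 1) u)"
    if "k \<ge> 1" for k :: real
    using gauss[of "s + 2 * k - 1"] s that by (simp_all add: algebra_simps)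

  \<comment> \<open>The series is indexed from \<open>k = 1\<close>, so the power \<open>2 * k - 1\<close> of the logarithmic series is
    \<open>2 * j + 1\<close> for \<open>k = Suc j\<close>.\<close>
  define T where "T j = (let k = real (Suc j) in
      1 / (2 * k - 1) * Beta (s + 2 * k) \<alpha>
        * incomplete_gauss (\<alpha> + 1) (s + 2 * k) (\<alpha> + s + 2 * k) l (- 1))" for j
  have T: "T j = 1 / real (2 * j + 1) * (LBINT u:{0..l}. moment_kernel \<alpha> (s + real (2 * j + 1)) u)"
    for j
  proof -
    have "2 * real (Suc j) - 1 = real (2 * j + 1)"
      and "s + 2 * real (Suc j) - 1 = s + real (2 * j + 1)"
      by simp_all
    then show ?thesis
      unfolding T_def Let_def mult.assoc using gauss_k(2)[of "real (Suc j)"] by (simp add: add_ac)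
  qed
  \<comment> \<open>The logarithmic series carries a factor \<open>2\<close>, which moves into the coefficient \<open>4 * p * \<alpha>\<^sup>2\<close>.\<close>
  have "2 / y * I / 2 = 1 / y * I" for y I :: real
    by simp
  then have T_sums: "T sums ((LBINT u:{0..l}. ?L u) / 2)"
    using sums_divide[OF L(2), of 2] by (simp only: T[symmetric])
  have "incomplete_moment (rtuomg_density \<alpha> \<beta> p) r z
      = 2 * \<alpha> * (1 - p) * Beta (s + 1) \<alpha> * incomplete_gauss (\<alpha> + 1) (s + 1) (\<alpha> + s + 1) l (- 1)
        + 4 * p * \<alpha>\<^sup>2 * (\<Sum>j. T j)"
    using T_sums by (simp add: incomplete_moment_def subst(2) int_h first(2)[symmetric] sums_iff)
  then show ?thesis
    using subst(1) first(1) gauss_k(1) sums_summable[OF T_sums]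
    unfolding T_def[abs_def] s_def l_def by simp
qed

end
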